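(* Let $X$ be a topological space, let $Y$ be a convex set in a topological vector space, and let $T\in KKM(Y,X)$ be compact. Let $Q:Y\to 2^{Y}$ be a correspondence and let $A\subseteq X\times Y$ satisfy: (a) $A$ is $T$-properly quasi-convex with respect to $Q$; (b) the correspondence $G:X\to 2^{Y}$ defined by $G(x)=\{y\in Y:P(x)\cap Q(y)=\emptyset\}$, where $P(x)=\{y\in Y:(x,y)\notin A\}$ for each $x\in X$, is such that $G^{-1}:Y\to 2^{X}$ is transfer closed-valued. Then there exists $x^{\ast}\in\overline{T(Y)}$ such that $(x^{\ast},z)\in A$ for all $z\in Q(Y)$.
   Context: A correspondence $T:Y\to 2^{X}$ assigns to each $y\in Y$ a subset $T(y)\subset X$; $T(B)=\bigcup_{y\in B}T(y)$ for $B\subset Y$ (so $Q(Y)=\bigcup_{y\in Y}Q(y)$). $T$ is compact if $\overline{T(Y)}$ is a compact subset of $X$. For $G:X\to 2^{Y}$, $G^{-1}(y)=\{x\in X:y\in G(x)\}$. $\operatorname{co}$ denotes the convex hull. Given $T,H:Y\to 2^{X}$, $H$ is a generalized KKM mapping w.r.t. $T$ if $T(\operatorname{co}B)\subset H(B)$ for each finite $B\subset Y$. $KKM(Y,X)$ is the set of $T:Y\to 2^{X}$ having the KKM property: for every $H:Y\to 2^{X}$ which is a generalized KKM mapping w.r.t. $T$, the family $\{\overline{H(y)}:y\in Y\}$ has the finite intersection property. $A\subseteq X\times Y$ is $T$-properly quasi-convex with respect to $Q:Y\to 2^{Y}$ if for each integer $n\ge 2$, all $y_1,\dots,y_n\in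 Y$, each $y\in\operatorname{co}\{y_1,\dots,y_n\}$ and each $x\in T(y)$, there exists $i_0\in\{1,\dots,n\}$ such that $(x,z)\in A$ for each $z\in Q(y_{i_0})$. A correspondence $H:Y\to 2^{X}$ is transfer closed-valued if for every $y\in Y$ and $x\in X$ with $x\notin H(y)$ there exists $y'\in Y$ such that $x\notin\overline{H(y')}$. *)

theory Defs
  imports "HOL-Analysis.Analysis"
begin

(* Not assumed Hausdorff. *)
class real_topological_vector_space = real_vector + topological_ab_group_add +
  assumes tendsto_scaleR_nhds:
    "((\<lambda>(c, x). c *\<^sub>R x) \<longlongrightarrow> a *\<^sub>R b) (nhds a \<times>\<^sub>F nhds b)"

instance real_normed_vector \<subseteq> real_topological_vector_space
proof
  fix a :: real and b :: 'a
  have "((\<lambda>p. fst p *\<^sub>R snd p) \<longlongrightarrow> a *\<^sub>R b) (nhds a \<times>\<^sub>F nhds b)"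
    by (intro tendsto_scaleR filterlim_fst filterlim_snd)
  then show "((\<lambda>(c, x). c *\<^sub>R x) \<longlongrightarrow> a *\<^sub>R b) (nhds a \<times>\<^sub>F nhds b)"
    by (simp add: case_prod_unfold)
qed

text \<open>
  A correspondence from \<open>S\<close> to subsets of \<open>R\<close> is a function in \<open>S \<rightarrow> Pow R\<close>; its values outside \<open>S\<close>
  are irrelevant. The space \<open>X\<close> is an abstract topology with points \<open>topspace X\<close>, and \<open>Y\<close> is a
  subset of a real vector space.
\<close>

definition lower_inverse :: "'a set \<Rightarrow> ('a \<Rightarrow> 'b set) \<Rightarrow> 'b \<Rightarrow> 'a set" where
  "lower_inverse S G y = {x \<in> S. y \<in> G x}"

definition compact_correspondence :: "'b set \<Rightarrow> 'a topology \<Rightarrow> ('b \<Rightarrow> 'a set) \<Rightarrow> bool" where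
  "compact_correspondence Y X T \<longleftrightarrow> compactin X (X closure_of (\<Union>y\<in>Y. T y))"

definition finite_intersection_property :: "'a set set \<Rightarrow> bool" where
  "finite_intersection_property \<F> \<longleftrightarrow>
     (\<forall>\<G>. finite \<G> \<and> \<G> \<subseteq> \<F> \<and> \<G> \<noteq> {} \<longrightarrow> \<Inter>\<G> \<noteq> {})"

definition generalized_KKM ::
    "'b::real_vector set \<Rightarrow> ('b \<Rightarrow> 'a set) \<Rightarrow> ('b \<Rightarrow> 'a set) \<Rightarrow> bool" where
  "generalized_KKM Y T H \<longleftrightarrow>
     (\<forall>B. finite B \<and> B \<subseteq> Y \<longrightarrow> (\<Union>y\<in>convex hull B. T y) \<subseteq> (\<Union>y\<in>B. H y))"

definition KKM :: "'b::real_vector set \<Rightarrow> 'a topology \<Rightarrow> ('b \<Rightarrow> 'a set) set" where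
  "KKM Y X = {T \<in> Y \<rightarrow> Pow (topspace X).
     \<forall>H \<in> Y \<rightarrow> Pow (topspace X). generalized_KKM Y T H \<longrightarrow>
       finite_intersection_property ((\<lambda>y. X closure_of H y) ` Y)}"

definition properly_quasi_convex ::
    "'b::real_vector set \<Rightarrow> ('b \<Rightarrow> 'a set) \<Rightarrow> ('b \<Rightarrow> 'b set) \<Rightarrow> ('a \<times> 'b) set \<Rightarrow> bool" where
  "properly_quasi_convex Y T Q A \<longleftrightarrow>
     (\<forall>n\<ge>2. \<forall>ys::nat \<Rightarrow> 'b. (\<forall>i\<in>{1..n}. ys i \<in> Y) \<longrightarrow>
        (\<forall>y \<in> convex hull (ys ` {1..n}). \<forall>x \<in> T y.
           \<exists>i\<^sub>0\<in>{1..n}. \<forall>z \<in> Q (ys i\<^sub>0). (x, z) \<in> A))"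

definition transfer_closed_valued :: "'b set \<Rightarrow> 'a topology \<Rightarrow> ('b \<Rightarrow> 'a set) \<Rightarrow> bool" where
  "transfer_closed_valued Y X H \<longleftrightarrow>
     (\<forall>y\<in>Y. \<forall>x\<in>topspace X. x \<notin> H y \<longrightarrow> (\<exists>y'\<in>Y. x \<notin> X closure_of H y'))"

end

theory Submission imports Defs begin

text \<open>
  The set \<open>{x. y \<in> G x}\<close> consists of the points \<open>x\<close> with \<open>(x, z) \<in> A\<close> for all \<open>z \<in> Q y\<close>, so the
  conclusion asks for a point of the closure \<open>K\<close> of \<open>T Y\<close> that lies in every such set. Proper
  quasi-convexity of \<open>A\<close> makes these sets a generalized KKM mapping for \<open>T\<close>, and
  transfer closedness says that replacing each of them by its closure does not change their
  intersection. Thus everything reduces to one fact about a compact \<open>T\<close> with the KKM property: the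
  closures of a generalized KKM mapping have a common point in \<open>K\<close>
  (\<open>KKM_compact_common_point\<close>).

  The KKM property alone yields finite intersections somewhere in \<open>X\<close>, not inside the compact set
  \<open>K\<close>. The remedy is to cut the mapping down to \<open>T Y\<close> first: this keeps it generalized KKM, since
  only values of \<open>T\<close> have to be covered, and it puts all the closures inside \<open>K\<close>.
\<close>

text \<open>
  The convex hull of a finite \<open>B \<subseteq> Y\<close> stays in the convex set \<open>Y\<close>, so the points that the
  mapping has to cover all lie in \<open>T Y\<close>.
\<close>

lemma generalized_KKM_Int_range:
  assumes "convex Y" and "generalized_KKM Y T H"
  shows "generalized_KKM Y T (\<lambda>y. H y \<inter> (\<Union>u\<in>Y. T u))"
  unfolding generalized_KKM_def
proof (intro allI impI)
  fix B assume B: "finite B \<and> B \<subseteq> Y"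
  then have "convex hull B \<subseteq> Y"
    using \<open>convex Y\<close> by (simp add: subset_hull)
  moreover have "(\<Union>y\<in>convex hull B. T y) \<subseteq> (\<Union>y\<in>B. H y)"
    using assms(2) B unfolding generalized_KKM_def by blast
  ultimately show "(\<Union>y\<in>convex hull B. T y) \<subseteq> (\<Union>y\<in>B. H y \<inter> (\<Union>u\<in>Y. T u))"
    by blast
qed

lemma KKM_compact_common_point:
  assumes "convex Y" and "Y \<noteq> {}"
    and T: "T \<in> KKM Y X" and cpt: "compact_correspondence Y X T"
    and H: "H \<in> Y \<rightarrow> Pow (topspace X)" and gen: "generalized_KKM Y T H"
  shows "\<exists>x \<in> X closure_of (\<Union>y\<in>Y. T y). \<forall>y\<in>Y. x \<in> X closure_of H y"
proof -
  let ?K = "X closure_of (\<Union>y\<in>Y. T y)"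
  define H' where "H' y = H y \<inter> (\<Union>u\<in>Y. T u)" for y
  define \<F> where "\<F> = (\<lambda>y. X closure_of H' y) ` Y"
  have "generalized_KKM Y T H'"
    using generalized_KKM_Int_range[OF \<open>convex Y\<close> gen] unfolding H'_def .
  moreover have "H' \<in> Y \<rightarrow> Pow (topspace X)"
    using H unfolding H'_def by blast
  ultimately have fip: "finite_intersection_property \<F>"
    using T unfolding KKM_def \<F>_def by blast
  have sub: "C \<subseteq> ?K" if "C \<in> \<F>" for C
    using that unfolding \<F>_def H'_def by (auto intro!: closure_of_mono)
  have "?K \<inter> \<Inter>\<G> \<noteq> {}" if \<G>: "finite \<G>" "\<G> \<subseteq> \<F>" for \<G>
  proof -
    \<comment> \<open>Adding one member of the family covers the empty \<open>\<G>\<close> as well and forces the common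
      point into \<open>?K\<close>.\<close>
    obtain C where C: "C \<in> \<F>"
      using \<open>Y \<noteq> {}\<close> unfolding \<F>_def by blast
    then have "finite (insert C \<G>)" "insert C \<G> \<subseteq> \<F>" "insert C \<G> \<noteq> {}"
      using \<G> by auto
    then have "\<Inter>(insert C \<G>) \<noteq> {}"
      using fip unfolding finite_intersection_property_def by metis
    then show ?thesis
      using sub[OF C] by auto
  qed
  moreover have "\<forall>C\<in>\<F>. closedin X C"
    unfolding \<F>_def by simp
  ultimately have "?K \<inter> \<Inter>\<F> \<noteq> {}"
    using cpt unfolding compact_correspondence_def compactin_fip by blast
  then obtain x where "x \<in> ?K" and x: "\<And>y. y \<in> Y \<Longrightarrow> x \<in> X closure_of H' y"
    unfolding \<F>_def by blast
  moreover have "X closure_of H' y \<subseteq> X closure_of H y" for y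
    unfolding H'_def by (simp add: closure_of_mono)
  ultimately show ?thesis
    by blast
qed

lemma transfer_closed_valued_common_point:
  assumes "transfer_closed_valued Y X H" and "x \<in> topspace X"
    and "\<And>y. y \<in> Y \<Longrightarrow> x \<in> X closure_of H y" and "y \<in> Y"
  shows "x \<in> H y"
  using assms unfolding transfer_closed_valued_def by blast

text \<open>
  Quasi-convexity is stated for families \<open>y\<^sub>1, \<dots>, y\<^sub>n\<close> with \<open>n \<ge> 2\<close>, whereas the KKM condition runs
  over all finite sets. The family may have repetitions, so a singleton can be listed twice; in
  general one extra copy of the last point makes the list of any nonempty finite set long enough.
\<close>

lemma properly_quasi_convex_imp_generalized_KKM:
  assumes qc: "properly_quasi_convex Y T Q A"
    and T: "T \<in> Y \<rightarrow> Pow S" and "convex Y"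
  shows "generalized_KKM Y T (\<lambda>y. {x \<in> S. \<forall>z \<in> Q y. (x, z) \<in> A})"
  unfolding generalized_KKM_def
proof (intro allI impI subsetI)
  fix B x
  assume B: "finite B \<and> B \<subseteq> Y" and "x \<in> (\<Union>y\<in>convex hull B. T y)"
  then obtain y where y: "y \<in> convex hull B" "x \<in> T y"
    by blast
  have "convex hull B \<subseteq> Y"
    using B \<open>convex Y\<close> by (simp add: subset_hull)
  then have "x \<in> S"
    using y T by blast
  have "B \<noteq> {}"
    using y by auto
  obtain f where f: "bij_betw f {1..card B} B"
    using B ex_bij_betw_nat_finite_1 by blast
  define n where "n = Suc (card B)"
  define ys where "ys i = f (min i (card B))" for i
  have "card B \<ge> 1"
    using B \<open>B \<noteq> {}\<close> by (simp add: Suc_le_eq card_gt_0_iff)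
  then have "n \<ge> 2"
    unfolding n_def by simp
  have "(\<lambda>i. min i (card B)) ` {1..n} = {1..card B}"
  proof (intro equalityI subsetI)
    fix i assume "i \<in> {1..card B}"
    then show "i \<in> (\<lambda>i. min i (card B)) ` {1..n}"
      unfolding n_def by (intro image_eqI[of _ _ i]) auto
  qed (use \<open>card B \<ge> 1\<close> in auto)
  moreover have "ys ` {1..n} = f ` (\<lambda>i. min i (card B)) ` {1..n}"
    unfolding ys_def image_image ..
  ultimately have img: "ys ` {1..n} = B"
    using f by (simp add: bij_betw_imp_surj_on)
  have "\<forall>i\<in>{1..n}. ys i \<in> Y"
    using img B by blast
  moreover have "y \<in> convex hull (ys ` {1..n})"
    using y img by simp
  ultimately obtain i where "i \<in> {1..n}" "\<forall>z \<in> Q (ys i). (x, z) \<in> A"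
    using qc[unfolded properly_quasi_convex_def, rule_format, OF \<open>n \<ge> 2\<close>, of ys y x] y(2)
    by metis
  then show "x \<in> (\<Union>y\<in>B. {x \<in> S. \<forall>z \<in> Q y. (x, z) \<in> A})"
    using img \<open>x \<in> S\<close> by blast
qed

theorem theorem3:
  fixes X :: "'a topology"
    and Y :: "'b::real_topological_vector_space set"
    and T :: "'b \<Rightarrow> 'a set"
    and Q :: "'b \<Rightarrow> 'b set"
    and A :: "('a \<times> 'b) set"
    and P G :: "'a \<Rightarrow> 'b set"
  assumes "convex Y" and "Y \<noteq> {}"
    and "T \<in> KKM Y X"
    and "compact_correspondence Y X T"
    and "Q \<in> Y \<rightarrow> Pow Y"
    and "A \<subseteq> topspace X \<times> Y"
    and "properly_quasi_convex Y T Q A"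
    and "\<And>x. x \<in> topspace X \<Longrightarrow> P x = {y \<in> Y. (x, y) \<notin> A}"
    and "\<And>x. x \<in> topspace X \<Longrightarrow> G x = {y \<in> Y. P x \<inter> Q y = {}}"
    and "transfer_closed_valued Y X (lower_inverse (topspace X) G)"
  shows "\<exists>x\<in>X closure_of (\<Union>y\<in>Y. T y). \<forall>z\<in>(\<Union>y\<in>Y. Q y). (x, z) \<in> A"
proof -
  define H where "H y = {x \<in> topspace X. \<forall>z \<in> Q y. (x, z) \<in> A}" for y
  have H_eq: "lower_inverse (topspace X) G y = H y" if "y \<in> Y" for y
  proof -
    have "Q y \<subseteq> Y"
      using assms(5) that by blast
    then show ?thesis
      using that by (fastforce simp: lower_inverse_def H_def assms(8,9))
  qed
  have tc: "transfer_closed_valued Y X H"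
    using assms(10) H_eq unfolding transfer_closed_valued_def by simp
  have "T \<in> Y \<rightarrow> Pow (topspace X)"
    using assms(3) unfolding KKM_def by blast
  then have "generalized_KKM Y T H"
    using properly_quasi_convex_imp_generalized_KKM[OF assms(7) _ assms(1)]
    unfolding H_def by blast
  moreover have "H \<in> Y \<rightarrow> Pow (topspace X)"
    unfolding H_def by blast
  ultimately obtain x where xK: "x \<in> X closure_of (\<Union>y\<in>Y. T y)"
      and x: "\<And>y. y \<in> Y \<Longrightarrow> x \<in> X closure_of H y"
    using KKM_compact_common_point[OF assms(1-4)] by blast
  have "x \<in> topspace X"
    using xK closure_of_subset_topspace by (rule subsetD[rotated])
  then have "x \<in> H y" if "y \<in> Y" for y
    using transfer_closed_valued_common_point[OF tc _ x] that by blast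
  then show ?thesis
    using xK unfolding H_def by blast
qed

end
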